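(* For all integers $2 \le i \le j \le n$, the group homomorphism $J_n^{i,j} \to J_n$ defined on generators by $s_{p,q} \mapsto s_{p,q}$ is injective.
   Context: For $n \ge 2$, the cactus group $J_n$ is the group with generators $s_{p,q}$ for $1 \le p < q \le n$ and relations: (j1) $s_{p,q}^2 = 1$; (j2) $s_{p,q}s_{m,r} = s_{m,r}s_{p,q}$ whenever $[p,q]\cap[m,r]=\emptyset$; (j3) $s_{p,q}s_{m,r} = s_{p+q-r,\,p+q-m}\,s_{p,q}$ whenever $[m,r]\subset[p,q]$ (intervals of integers). The leaf number of $s_{p,q}$ is $q-p+1$. For $2\le i\le j\le n$, $J_n^{i,j}$ is the group with generators $s_{p,q}$ for $1\le p<q\le n$ with $i \le q-p+1 \le j$, and as relations all the relations (j1)–(j3) that involve only these generators. *)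

theory Defs
  imports "HOL-Algebra.Group"
begin

text \<open>The letter \<open>(x, True)\<close> stands for the generator \<open>x\<close>, the letter \<open>(x, False)\<close> for its
  formal inverse. A relation \<open>l = r\<close> is a pair of words \<open>(l, r)\<close>.\<close>

type_synonym 'a word = "('a \<times> bool) list"

definition words :: "'a set \<Rightarrow> 'a word set" where
  "words S = lists (S \<times> UNIV)"

inductive_set pres_cong :: "'a set \<Rightarrow> ('a word \<times> 'a word) set \<Rightarrow> ('a word \<times> 'a word) set"
  for S :: "'a set" and R :: "('a word \<times> 'a word) set" where
  refl: "w \<in> words S \<Longrightarrow> (w, w) \<in> pres_cong S R"
| sym: "(v, w) \<in> pres_cong S R \<Longrightarrow> (w, v) \<in> pres_cong S R"
| trans: "(u, v) \<in> pres_cong S R \<Longrightarrow> (v, w) \<in> pres_cong S R \<Longrightarrow> (u, w) \<in> pres_cong S R"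
| cancel: "u \<in> words S \<Longrightarrow> v \<in> words S \<Longrightarrow> x \<in> S \<Longrightarrow>
    (u @ [(x, b), (x, \<not> b)] @ v, u @ v) \<in> pres_cong S R"
| rel: "u \<in> words S \<Longrightarrow> v \<in> words S \<Longrightarrow> (l, r) \<in> R \<Longrightarrow>
    (u @ l @ v, u @ r @ v) \<in> pres_cong S R"

text \<open>The group \<open>\<langle>S | R\<rangle>\<close>; meaningful if all relations are between words over \<open>S\<close>.\<close>

definition presented_group :: "'a set \<Rightarrow> ('a word \<times> 'a word) set \<Rightarrow> 'a word set monoid" where
  "presented_group S R =
    \<lparr>carrier = words S // pres_cong S R,
     monoid.mult = (\<lambda>A B. \<Union>a\<in>A. \<Union>b\<in>B. pres_cong S R `` {a @ b}),
     one = pres_cong S R `` {[]}\<rparr>"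

definition pres_gen :: "'a set \<Rightarrow> ('a word \<times> 'a word) set \<Rightarrow> 'a \<Rightarrow> 'a word set" where
  "pres_gen S R x = pres_cong S R `` {[(x, True)]}"

lemma words_simps [simp]:
  "[] \<in> words S"
  "a # w \<in> words S \<longleftrightarrow> fst a \<in> S \<and> w \<in> words S"
  "v @ w \<in> words S \<longleftrightarrow> v \<in> words S \<and> w \<in> words S"
  "rev w \<in> words S \<longleftrightarrow> w \<in> words S"
  by (cases a; auto simp: words_def)+

context
  fixes S :: "'a set" and R :: "('a word \<times> 'a word) set"
  assumes R: "R \<subseteq> words S \<times> words S"
begin

lemma pres_cong_words: "(v, w) \<in> pres_cong S R \<Longrightarrow> v \<in> words S \<and> w \<in> words S"
  by (induction rule: pres_cong.induct) (use R in auto)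

lemma equiv_pres_cong: "equiv (words S) (pres_cong S R)"
proof (rule equivI)
  show "pres_cong S R \<subseteq> words S \<times> words S" using pres_cong_words by auto
  show "refl_on (words S) (pres_cong S R)"
    by (auto intro!: refl_onI pres_cong.refl)
  show "sym_on UNIV (pres_cong S R)" by (rule symI) (rule pres_cong.sym)
  show "trans_on UNIV (pres_cong S R)" by (rule transI) (rule pres_cong.trans)
qed

lemma pres_cong_append_left:
  "(v, w) \<in> pres_cong S R \<Longrightarrow> a \<in> words S \<Longrightarrow> (a @ v, a @ w) \<in> pres_cong S R"
proof (induction rule: pres_cong.induct)
  case (cancel u v x b)
  then show ?case using pres_cong.cancel[of "a @ u" S v x b R] by simp
next
  case (rel u v l r)
  then show ?case using pres_cong.rel[of "a @ u" S v l r R] by simp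
next
  case (trans u v w)
  then show ?case by (blast intro: pres_cong.trans)
qed (simp_all add: pres_cong.refl pres_cong.sym)

lemma pres_cong_append_right:
  "(v, w) \<in> pres_cong S R \<Longrightarrow> a \<in> words S \<Longrightarrow> (v @ a, w @ a) \<in> pres_cong S R"
proof (induction rule: pres_cong.induct)
  case (cancel u v x b)
  then show ?case using pres_cong.cancel[of u S "v @ a" x b R] by simp
next
  case (rel u v l r)
  then show ?case using pres_cong.rel[of u S "v @ a" l r R] by simp
next
  case (trans u v w)
  then show ?case by (blast intro: pres_cong.trans)
qed (simp_all add: pres_cong.refl pres_cong.sym)

lemma pres_cong_append:
  "(v, w) \<in> pres_cong S R \<Longrightarrow> (v', w') \<in> pres_cong S R \<Longrightarrow> (v @ v', w @ w') \<in> pres_cong S R"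
  by (meson pres_cong.trans pres_cong_append_left pres_cong_append_right pres_cong_words)

lemma presented_group_mult:
  assumes "v \<in> words S" "w \<in> words S"
  shows "pres_cong S R `` {v} \<otimes>\<^bsub>presented_group S R\<^esub> pres_cong S R `` {w} =
    pres_cong S R `` {v @ w}"
proof -
  have "pres_cong S R `` {a @ b} = pres_cong S R `` {v @ w}"
    if "(v, a) \<in> pres_cong S R" "(w, b) \<in> pres_cong S R" for a b
    using equiv_class_eq[OF equiv_pres_cong pres_cong_append[OF that]] by simp
  moreover have "(v, v) \<in> pres_cong S R" "(w, w) \<in> pres_cong S R"
    using assms by (auto intro: pres_cong.refl)
  ultimately have "(\<Union>a\<in>pres_cong S R `` {v}. \<Union>b\<in>pres_cong S R `` {w}. pres_cong S R `` {a @ b}) =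
      pres_cong S R `` {v @ w}"
    by blast
  then show ?thesis by (simp add: presented_group_def)
qed

lemma pres_cong_inverse:
  "w \<in> words S \<Longrightarrow> (rev (map (\<lambda>(x, b). (x, \<not> b)) w) @ w, []) \<in> pres_cong S R"
proof (induction w)
  case Nil
  then show ?case by (auto intro: pres_cong.refl)
next
  case (Cons a w)
  obtain x b where a: "a = (x, b)" by force
  let ?i = "rev (map (\<lambda>(x, b). (x, \<not> b)) w)"
  have "map (\<lambda>(x, b). (x, \<not> b)) w \<in> words S"
    using Cons.prems by (auto simp: words_def in_lists_conv_set)
  then have "(?i @ [(x, \<not> b), (x, \<not> \<not> b)] @ w, ?i @ w) \<in> pres_cong S R"
    using Cons.prems a by (intro pres_cong.cancel) auto
  then have "(?i @ [(x, \<not> b), (x, \<not> \<not> b)] @ w, []) \<in> pres_cong S R"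
    by (rule pres_cong.trans) (use Cons in simp)
  then show ?case by (simp add: a)
qed

lemma group_presented_group: "group (presented_group S R)"
proof (rule groupI)
  let ?G = "presented_group S R"
  have carr: "carrier ?G = words S // pres_cong S R"
    and one: "\<one>\<^bsub>?G\<^esub> = pres_cong S R `` {[]}"
    by (simp_all add: presented_group_def)
  note m = presented_group_mult
  show "\<one>\<^bsub>?G\<^esub> \<in> carrier ?G" by (simp add: carr one quotientI)
  fix A assume A: "A \<in> carrier ?G"
  then obtain a where a: "a \<in> words S" "A = pres_cong S R `` {a}"
    by (auto simp: carr elim: quotientE)
  show "\<one>\<^bsub>?G\<^esub> \<otimes>\<^bsub>?G\<^esub> A = A" using a m[of "[]" a] by (simp add: one)
  let ?i = "rev (map (\<lambda>(x, b). (x, \<not> b)) a)"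
  have i: "?i \<in> words S" using a by (auto simp: words_def in_lists_conv_set)
  show "\<exists>B\<in>carrier ?G. B \<otimes>\<^bsub>?G\<^esub> A = \<one>\<^bsub>?G\<^esub>"
    using a i m[OF i a(1)] equiv_class_eq[OF equiv_pres_cong pres_cong_inverse[OF a(1)]]
    by (intro bexI[of _ "pres_cong S R `` {?i}"]) (auto simp: one carr quotientI)
  fix B assume "B \<in> carrier ?G"
  then obtain b where b: "b \<in> words S" "B = pres_cong S R `` {b}"
    by (auto simp: carr elim: quotientE)
  show "A \<otimes>\<^bsub>?G\<^esub> B \<in> carrier ?G" using a b by (simp add: m carr quotientI)
  fix C assume "C \<in> carrier ?G"
  then obtain c where c: "c \<in> words S" "C = pres_cong S R `` {c}"
    by (auto simp: carr elim: quotientE)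
  show "A \<otimes>\<^bsub>?G\<^esub> B \<otimes>\<^bsub>?G\<^esub> C = A \<otimes>\<^bsub>?G\<^esub> (B \<otimes>\<^bsub>?G\<^esub> C)" using a b c by (simp add: m)
qed

end

text \<open>The pair \<open>(p, q)\<close> names the generator \<open>s\<^sub>p\<^sub>,\<^sub>q\<close>.\<close>

definition cactus_gens :: "nat \<Rightarrow> (nat \<times> nat) set" where
  "cactus_gens n = {(p, q). 1 \<le> p \<and> p < q \<and> q \<le> n}"

definition leaf_number :: "nat \<times> nat \<Rightarrow> nat" where
  "leaf_number = (\<lambda>(p, q). q - p + 1)"

abbreviation s_letter :: "nat \<Rightarrow> nat \<Rightarrow> (nat \<times> nat) \<times> bool" where
  "s_letter p q \<equiv> ((p, q), True)"

text \<open>In the last family \<open>m \<le> r \<le> q\<close>, so the natural number subtractions do not truncate.\<close>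

definition cactus_rels :: "nat \<Rightarrow> ((nat \<times> nat) word \<times> (nat \<times> nat) word) set" where
  "cactus_rels n =
    {([s_letter p q, s_letter p q], []) | p q. (p, q) \<in> cactus_gens n} \<union>
    {([s_letter p q, s_letter m r], [s_letter m r, s_letter p q]) | p q m r.
      (p, q) \<in> cactus_gens n \<and> (m, r) \<in> cactus_gens n \<and> {p..q} \<inter> {m..r} = {}} \<union>
    {([s_letter p q, s_letter m r], [s_letter (p + q - r) (p + q - m), s_letter p q]) | p q m r.
      (p, q) \<in> cactus_gens n \<and> (m, r) \<in> cactus_gens n \<and> {m..r} \<subseteq> {p..q}}"

definition cactus_group :: "nat \<Rightarrow> (nat \<times> nat) word set monoid" where
  "cactus_group n = presented_group (cactus_gens n) (cactus_rels n)"

definition cactus_s :: "nat \<Rightarrow> nat \<times> nat \<Rightarrow> (nat \<times> nat) word set" where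
  "cactus_s n = pres_gen (cactus_gens n) (cactus_rels n)"

definition sub_cactus_gens :: "nat \<Rightarrow> nat \<Rightarrow> nat \<Rightarrow> (nat \<times> nat) set" where
  "sub_cactus_gens n i j = {g \<in> cactus_gens n. i \<le> leaf_number g \<and> leaf_number g \<le> j}"

definition sub_cactus_rels ::
    "nat \<Rightarrow> nat \<Rightarrow> nat \<Rightarrow> ((nat \<times> nat) word \<times> (nat \<times> nat) word) set" where
  "sub_cactus_rels n i j =
    cactus_rels n \<inter> (words (sub_cactus_gens n i j) \<times> words (sub_cactus_gens n i j))"

definition sub_cactus_group :: "nat \<Rightarrow> nat \<Rightarrow> nat \<Rightarrow> (nat \<times> nat) word set monoid" where
  "sub_cactus_group n i j = presented_group (sub_cactus_gens n i j) (sub_cactus_rels n i j)"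

definition sub_cactus_s :: "nat \<Rightarrow> nat \<Rightarrow> nat \<Rightarrow> nat \<times> nat \<Rightarrow> (nat \<times> nat) word set" where
  "sub_cactus_s n i j = pres_gen (sub_cactus_gens n i j) (sub_cactus_rels n i j)"

lemma cactus_rels_words: "cactus_rels n \<subseteq> words (cactus_gens n) \<times> words (cactus_gens n)"
  by (auto simp: cactus_rels_def cactus_gens_def)

lemma group_cactus_group: "group (cactus_group n)"
  unfolding cactus_group_def by (rule group_presented_group[OF cactus_rels_words])

lemma group_sub_cactus_group: "group (sub_cactus_group n i j)"
  unfolding sub_cactus_group_def sub_cactus_rels_def by (rule group_presented_group) blast

end

theory Submission
  imports Defs "HOL-Algebra.Coset"
begin

text \<open>The cactus group acts on integer-valued functions on sets of strands: the generator
  \<open>s\<^sub>p\<^sub>,\<^sub>q\<close> permutes the strands by reversing the interval \<open>[p,q]\<close> and then applies the reflection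
  \<open>\<tau>\<^sub>I\<close>, \<open>I = [p,q]\<close>, of the (dual) geometric representation of the right-angled Coxeter group whose
  generators are indexed by sets of strands, two of them commuting if the sets are disjoint or
  nested. Let a word over the generators of \<open>J\<^sub>n\<^sup>i\<^sup>,\<^sup>j\<close> have minimal length in its class in
  \<open>J\<^sub>n\<^sup>i\<^sup>,\<^sup>j\<close>, and let it act on the constant function 1. The set \<open>I\<close> receives a negative value
  only if the word is equal in \<open>J\<^sub>n\<^sup>i\<^sup>,\<^sup>j\<close> to a word of the same length that begins with the
  generator of \<open>I\<close>: two generators whose reflections commute can be exchanged by a relation that
  preserves leaf numbers. Hence a nonempty minimal word moves the constant function 1, and it is
  nontrivial in \<open>J\<^sub>n\<close>.\<close>

section \<open>The action of the cactus group\<close>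

definition disjoint_or_nested :: "'a set \<Rightarrow> 'a set \<Rightarrow> bool" where
  "disjoint_or_nested A B \<longleftrightarrow> A \<inter> B = {} \<or> A \<subseteq> B \<or> B \<subseteq> A"

text \<open>Read \<open>f B\<close> as the value of a linear functional at the simple root of
  \<open>B\<close>. The factor 2 reflects the form value -1 on two simple roots whose reflections
  generate an infinite dihedral group.\<close>

definition set_reflection :: "'a set \<Rightarrow> ('a set \<Rightarrow> int) \<Rightarrow> 'a set \<Rightarrow> int" where
  "set_reflection A f B =
    (if B = A then - f A else if disjoint_or_nested A B then f B else f B + 2 * f A)"

definition span :: "nat \<times> nat \<Rightarrow> nat set" where
  "span x = {fst x..snd x}"

definition reversal :: "nat \<times> nat \<Rightarrow> nat \<Rightarrow> nat" where
  "reversal x k = (if k \<in> span x then fst x + snd x - k else k)"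

definition gen_act :: "nat \<times> nat \<Rightarrow> (nat set \<Rightarrow> int) \<Rightarrow> nat set \<Rightarrow> int" where
  "gen_act x f = set_reflection (span x) (\<lambda>B. f (reversal x ` B))"

text \<open>The sign of a letter is dropped because \<open>gen_act x\<close> is an involution. The
  last letter acts first.\<close>

definition word_act :: "(nat \<times> nat) word \<Rightarrow> (nat set \<Rightarrow> int) \<Rightarrow> nat set \<Rightarrow> int" where
  "word_act w = foldr (\<lambda>a. gen_act (fst a)) w"

lemma word_act_simps [simp]:
  "word_act [] f = f"
  "word_act (a # w) f = gen_act (fst a) (word_act w f)"
  "word_act (v @ w) f = word_act v (word_act w f)"
  by (simp_all add: word_act_def)

lemma disjoint_or_nested_refl [simp]: "disjoint_or_nested A A"
  by (simp add: disjoint_or_nested_def)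

lemma disjoint_or_nested_sym: "disjoint_or_nested A B \<longleftrightarrow> disjoint_or_nested B A"
  by (auto simp: disjoint_or_nested_def)

lemma disjoint_or_nested_image:
  "inj h \<Longrightarrow> disjoint_or_nested (h ` A) (h ` B) \<longleftrightarrow> disjoint_or_nested A B"
  by (simp add: disjoint_or_nested_def image_Int[symmetric] inj_image_subset_iff)

lemma set_reflection_image:
  "inj h \<Longrightarrow> set_reflection (h ` A) f (h ` B) = set_reflection A (\<lambda>C. f (h ` C)) B"
  by (simp add: set_reflection_def disjoint_or_nested_image inj_image_eq_iff)

lemma set_reflection_involution: "set_reflection A (set_reflection A f) = f"
  by (auto simp: set_reflection_def fun_eq_iff)

text \<open>For distinct \<open>A\<close> and \<open>B\<close>, neither reflection changes the value
  at the other set, so their contributions at a third set add up independently.\<close>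

lemma set_reflection_commute:
  "disjoint_or_nested A B \<Longrightarrow>
    set_reflection A (set_reflection B f) = set_reflection B (set_reflection A f)"
  using disjoint_or_nested_sym[of A B] by (auto simp: set_reflection_def fun_eq_iff)

section \<open>Reversals of intervals\<close>

lemma reversal_involution [simp]: "reversal x (reversal x k) = k"
  by (auto simp: reversal_def span_def)

lemma image_reversal_involution [simp]: "reversal x ` reversal x ` A = A"
  by (simp add: image_image)

lemma inj_reversal: "inj (reversal x)"
  by (metis injI reversal_involution)

lemma image_reversal_disjoint:
  assumes "span x \<inter> A = {}"
  shows "reversal x ` A = A"
proof -
  have "reversal x k = k" if "k \<in> A" for k
    using assms that by (auto simp: reversal_def)
  then show ?thesis by simp
qed

lemma image_reversal_superset:
  assumes "span x \<subseteq> A"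
  shows "reversal x ` A = A"
proof -
  have sub: "reversal x k \<in> A" if "k \<in> A" for k
    using that by (auto simp: reversal_def span_def intro!: subsetD[OF assms])
  then have "reversal x ` A \<subseteq> A" by blast
  moreover from this have "reversal x ` reversal x ` A \<subseteq> reversal x ` A" by blast
  ultimately show ?thesis by simp
qed

lemma image_reversal_interval:
  assumes "m \<le> r" "{m..r} \<subseteq> {p..q}"
  shows "reversal (p, q) ` {m..r} = {p + q - r..p + q - m}"
proof -
  have "p \<le> m" "r \<le> q" using assms by auto
  then have "k \<in> reversal (p, q) ` {m..r}" if "k \<in> {p + q - r..p + q - m}" for k
    using that assms(1)
    by (intro image_eqI[of _ _ "p + q - k"]) (auto simp: reversal_def span_def)
  with \<open>p \<le> m\<close> \<open>r \<le> q\<close> assms(1) show ?thesis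
    by (auto simp: reversal_def span_def)
qed

text \<open>Pulling both reversals inside turns a product of two generators into two reflections and
  a permutation of strands, so a relation splits into a claim about sets and one about
  permutations.\<close>

lemma gen_act_gen_act:
  "gen_act x (gen_act y f) =
    set_reflection (span x) (set_reflection (reversal x ` span y)
      (\<lambda>B. f (reversal y ` reversal x ` B)))"
  using set_reflection_image[OF inj_reversal, of x "reversal x ` span y"]
  by (simp add: gen_act_def)

section \<open>The cactus relations hold for the action\<close>

lemma gen_act_involution: "gen_act x (gen_act x f) = f"
  by (simp add: gen_act_gen_act image_reversal_superset set_reflection_involution)

lemma gen_act_commute:
  assumes "span x \<inter> span y = {}"
  shows "gen_act x (gen_act y f) = gen_act y (gen_act x f)"
proof -
  have "reversal y (reversal x k) = reversal x (reversal y k)" for k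
  proof -
    have "reversal x k \<in> span x" if "k \<in> span x" for x k
      using that by (auto simp: reversal_def span_def)
    then show ?thesis using assms by (smt (verit) disjoint_iff reversal_def)
  qed
  then have "reversal y ` reversal x ` B = reversal x ` reversal y ` B" for B
    by (simp add: image_image)
  moreover have "reversal x ` span y = span y" "reversal y ` span x = span x"
    using assms by (auto intro!: image_reversal_disjoint)
  moreover have "disjoint_or_nested (span x) (span y)"
    using assms by (simp add: disjoint_or_nested_def)
  ultimately show ?thesis
    by (simp add: gen_act_gen_act) (rule set_reflection_commute)
qed

text \<open>The reversal of [p,q] conjugates the reversal of [m,r] into that of the mirror image
  \<open>?z\<close> and maps [m,r] onto the span of \<open>?z\<close>. The two reflections commute
  since this span lies in [p,q].\<close>

lemma gen_act_nested:
  assumes "m \<le> r" "{m..r} \<subseteq> {p..q}"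
  shows "gen_act (p, q) (gen_act (m, r) f) =
    gen_act (p + q - r, p + q - m) (gen_act (p, q) f)"
proof -
  let ?z = "(p + q - r, p + q - m)"
  have bounds: "p \<le> m" "r \<le> q" using assms by auto
  then have "reversal (m, r) (reversal (p, q) k) = reversal (p, q) (reversal ?z k)" for k
    using assms(1) by (auto simp: reversal_def span_def)
  then have "reversal (m, r) ` reversal (p, q) ` B = reversal (p, q) ` reversal ?z ` B" for B
    by (simp add: image_image)
  moreover have img: "reversal (p, q) ` span (m, r) = span ?z"
    using image_reversal_interval[OF assms] by (simp add: span_def)
  moreover have sub: "span ?z \<subseteq> span (p, q)"
    using assms(1) bounds by (auto simp: span_def)
  moreover have "reversal ?z ` span (p, q) = span (p, q)"
    using sub by (rule image_reversal_superset)
  moreover have "disjoint_or_nested (span (p, q)) (span ?z)"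
    using sub by (simp add: disjoint_or_nested_def)
  ultimately show ?thesis
    by (simp add: gen_act_gen_act) (rule set_reflection_commute)
qed

lemma word_act_rel:
  assumes "(l, r) \<in> cactus_rels n"
  shows "word_act l f = word_act r f"
proof -
  from assms consider
    (square) p q where "l = [s_letter p q, s_letter p q]" "r = []"
  | (commute) p q m k where "l = [s_letter p q, s_letter m k]" "r = [s_letter m k, s_letter p q]"
      "{p..q} \<inter> {m..k} = {}"
  | (nested) p q m k where "l = [s_letter p q, s_letter m k]"
      "r = [s_letter (p + q - k) (p + q - m), s_letter p q]" "m < k" "{m..k} \<subseteq> {p..q}"
    unfolding cactus_rels_def cactus_gens_def by blast
  then show ?thesis
  proof cases
    case square
    then show ?thesis by (simp add: gen_act_involution)
  next
    case (commute p q m k)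
    then show ?thesis using gen_act_commute[of "(p, q)" "(m, k)"] by (simp add: span_def)
  next
    case (nested p q m k)
    then show ?thesis using gen_act_nested[of m k p q] by simp
  qed
qed

lemma word_act_cong:
  "(v, w) \<in> pres_cong (cactus_gens n) (cactus_rels n) \<Longrightarrow> word_act v f = word_act w f"
  by (induction arbitrary: f rule: pres_cong.induct)
    (simp_all add: gen_act_involution word_act_rel)

section \<open>Minimal words\<close>

abbreviation sub_cactus_cong ::
    "nat \<Rightarrow> nat \<Rightarrow> nat \<Rightarrow> ((nat \<times> nat) word \<times> (nat \<times> nat) word) set" where
  "sub_cactus_cong n i j \<equiv> pres_cong (sub_cactus_gens n i j) (sub_cactus_rels n i j)"

lemma sub_cactus_rels_words:
  "sub_cactus_rels n i j \<subseteq> words (sub_cactus_gens n i j) \<times> words (sub_cactus_gens n i j)"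
  by (auto simp: sub_cactus_rels_def)

lemma sub_cactus_cong_rel:
  "(l, r) \<in> cactus_rels n \<Longrightarrow> l \<in> words (sub_cactus_gens n i j) \<Longrightarrow>
    r \<in> words (sub_cactus_gens n i j) \<Longrightarrow> (l, r) \<in> sub_cactus_cong n i j"
  using pres_cong.rel[of "[]" _ "[]" l r] by (simp add: sub_cactus_rels_def)

lemma words_mono: "S \<subseteq> T \<Longrightarrow> words S \<subseteq> words T"
  by (auto simp: words_def)

lemma pres_cong_mono:
  assumes "S \<subseteq> T" "R \<subseteq> Q"
  shows "pres_cong S R \<subseteq> pres_cong T Q"
proof -
  have "(v, w) \<in> pres_cong T Q" if "(v, w) \<in> pres_cong S R" for v w
    using that
  proof induction
    case (trans u v w)
    then show ?case by (blast intro: pres_cong.trans)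
  qed (use assms words_mono[OF assms(1)] in
      \<open>auto intro: pres_cong.refl pres_cong.sym pres_cong.cancel[simplified] pres_cong.rel\<close>)
  then show ?thesis by auto
qed

lemma sub_cactus_cong_subset:
  "sub_cactus_cong n i j \<subseteq> pres_cong (cactus_gens n) (cactus_rels n)"
  by (rule pres_cong_mono) (auto simp: sub_cactus_gens_def sub_cactus_rels_def)

context
  fixes n i j :: nat
begin

private abbreviation (input) "S \<equiv> sub_cactus_gens n i j"
private abbreviation (input) sub_cactus_eq (infix \<open>\<approx>\<close> 50) where
  "v \<approx> w \<equiv> (v, w) \<in> sub_cactus_cong n i j"

lemmas sub_cactus_cong_append_left = pres_cong_append_left[OF sub_cactus_rels_words]
lemmas sub_cactus_cong_append_right = pres_cong_append_right[OF sub_cactus_rels_words]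

section \<open>Exchange of generators inside J_n^{i,j}\<close>

lemma sub_cactus_cong_square:
  assumes "x \<in> S"
  shows "[(x, True), (x, True)] \<approx> []"
proof (rule sub_cactus_cong_rel)
  show "([(x, True), (x, True)], []) \<in> cactus_rels n"
    using assms by (cases x) (auto simp: cactus_rels_def sub_cactus_gens_def)
qed (use assms in auto)

text \<open>The word x x x^-1 reduces to either side, by the square relation and by free
  cancellation.\<close>

lemma sub_cactus_cong_letter:
  assumes "x \<in> S"
  shows "[(x, b)] \<approx> [(x, True)]"
proof (cases b)
  case True
  then show ?thesis using assms by (auto intro: pres_cong.refl)
next
  case False
  have "[(x, True), (x, True), (x, False)] \<approx> [(x, False)]"
    using sub_cactus_cong_append_right[OF sub_cactus_cong_square, of x "[(x, False)]"] assms by simp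
  moreover have "[(x, True), (x, True), (x, False)] \<approx> [(x, True)]"
    using pres_cong.cancel[of "[(x, True)]" S "[]" x True] assms by simp
  ultimately have "[(x, False)] \<approx> [(x, True)]"
    by (rule pres_cong.trans[OF pres_cong.sym])
  then show ?thesis using False by simp
qed

text \<open>By \<open>gen_act_gen_act\<close>, the two sets in the hypothesis are those of the
  reflections in the product, so commuting reflections can be exchanged. Mirroring an interval keeps
  its leaf number, hence the new generators stay in \<open>S\<close>.\<close>

lemma sub_cactus_cong_swap:
  assumes "x \<in> S" "y \<in> S" "disjoint_or_nested (span x) (reversal x ` span y)"
  obtains z x' where "z \<in> S" "x' \<in> S" "span z = reversal x ` span y"
    "[(x, True), (y, True)] \<approx> [(z, True), (x', True)]"
proof -
  obtain p q m r where xy [simp]: "x = (p, q)" "y = (m, r)" by fastforce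
  have lt: "p < q" "m < r" using assms by (auto simp: sub_cactus_gens_def cactus_gens_def)
  \<comment> \<open>The reversal of \<open>x\<close> preserves \<open>span x\<close>, so the
    hypothesis can be pulled back to \<open>span y\<close>.\<close>
  have "reversal x ` span x = span x" by (simp add: image_reversal_superset)
  then have "disjoint_or_nested (span x) (span y)"
    using assms(3) by (metis disjoint_or_nested_image inj_reversal)
  then consider "span x \<inter> span y = {}" | "span y \<subseteq> span x" | "span x \<subseteq> span y"
    by (auto simp: disjoint_or_nested_def)
  then show thesis
  proof cases
    case 1
    have "[(x, True), (y, True)] \<approx> [(y, True), (x, True)]"
    proof (rule sub_cactus_cong_rel)
      show "([(x, True), (y, True)], [(y, True), (x, True)]) \<in> cactus_rels n"
        using 1 assms by (auto simp: cactus_rels_def sub_cactus_gens_def span_def)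
    qed (use assms in auto)
    then show thesis using that[of y x] 1 assms by (simp add: image_reversal_disjoint)
  next
    case 2
    let ?z = "(p + q - r, p + q - m)"
    have b: "p \<le> m" "r \<le> q" using 2 lt by (auto simp: span_def)
    then have z: "?z \<in> S"
      using assms lt by (auto simp: sub_cactus_gens_def cactus_gens_def leaf_number_def)
    have "[(x, True), (y, True)] \<approx> [(?z, True), (x, True)]"
    proof (rule sub_cactus_cong_rel)
      show "([(x, True), (y, True)], [(?z, True), (x, True)]) \<in> cactus_rels n"
        using 2 assms by (auto simp: cactus_rels_def sub_cactus_gens_def span_def)
    qed (use assms z in auto)
    moreover have "span ?z = reversal x ` span y"
      using image_reversal_interval[of m r p q] lt 2 by (simp add: span_def)
    ultimately show thesis using that[of ?z x] z assms by simp
  next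
    case 3
    \<comment> \<open>Mirroring \<open>x\<close> twice inside \<open>span y\<close> gives back
      \<open>x\<close>, so (j3) for \<open>y\<close> and \<open>?x\<close>, read from right to left,
      is the exchange.\<close>
    let ?x = "(m + r - q, m + r - p)"
    have b: "m \<le> p" "q \<le> r" using 3 lt by (auto simp: span_def)
    then have x: "?x \<in> S"
      using assms lt by (auto simp: sub_cactus_gens_def cactus_gens_def leaf_number_def)
    have "{m + r - q..m + r - p} \<subseteq> {m..r}" using b lt by auto
    moreover have "m + r - (m + r - p) = p" "m + r - (m + r - q) = q" using b lt by auto
    ultimately have "([(y, True), (?x, True)], [(x, True), (y, True)]) \<in> cactus_rels n"
      using assms x unfolding cactus_rels_def sub_cactus_gens_def xy
      by (intro UnI2 CollectI exI[of _ m] exI[of _ r] exI[of _ "m + r - q"] exI[of _ "m + r - p"])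
        simp
    then have "[(y, True), (?x, True)] \<approx> [(x, True), (y, True)]"
      by (rule sub_cactus_cong_rel) (use assms x in auto)
    then have "[(x, True), (y, True)] \<approx> [(y, True), (?x, True)]"
      by (rule pres_cong.sym)
    then show thesis using that[of y ?x] x 3 assms by (simp add: image_reversal_superset)
  qed
qed

section \<open>Signs of the values produced by minimal words\<close>

definition minimal_word :: "(nat \<times> nat) word \<Rightarrow> bool" where
  "minimal_word w \<longleftrightarrow> w \<in> words S \<and> (\<forall>v. w \<approx> v \<longrightarrow> length w \<le> length v)"

lemma minimal_word_exists:
  assumes "w \<in> words S"
  obtains v where "w \<approx> v" "minimal_word v"
proof -
  have "w \<approx> w" using assms by (rule pres_cong.refl)
  then obtain v where v: "w \<approx> v" "\<forall>u. w \<approx> u \<longrightarrow> length v \<le> length u"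
    using ex_has_least_nat[of "\<lambda>v. w \<approx> v" w length] by blast
  then have "minimal_word v"
    using pres_cong_words[OF sub_cactus_rels_words]
    by (auto simp: minimal_word_def intro: pres_cong.trans)
  with v that show thesis by blast
qed

lemma minimal_word_Cons:
  assumes "minimal_word (a # w)"
  shows "minimal_word w"
proof -
  have "length w \<le> length v" if "w \<approx> v" for v
    using sub_cactus_cong_append_left[OF that, of "[a]"] assms by (fastforce simp: minimal_word_def)
  then show ?thesis using assms by (simp add: minimal_word_def)
qed

text \<open>Prepending a generator with span \<open>I\<close> adds twice the value at \<open>I\<close> to the value at a set \<open>A\<close> that
  is neither disjoint from nor nested with \<open>I\<close>; the second conclusion makes the result positive.\<close>

lemma word_act_minimal_word:
  assumes "minimal_word w"
  shows "word_act w (\<lambda>_. 1) A > 0 \<or>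
      word_act w (\<lambda>_. 1) A < 0 \<and>
      (\<exists>x v. x \<in> S \<and> span x = A \<and> w \<approx> (x, True) # v \<and> length w = Suc (length v))"
    and "\<not> disjoint_or_nested A B \<Longrightarrow> word_act w (\<lambda>_. 1) A + word_act w (\<lambda>_. 1) B > 0"
    and "w = a # v \<Longrightarrow> word_act w (\<lambda>_. 1) (span (fst a)) < 0"
  using assms
proof (induction w arbitrary: A B a v)
  case Nil
  {
    case 1
    show ?case by simp
  next
    case 2
    show ?case by simp
  next
    case 3
    then show ?case by simp
  }
next
  case (Cons c w)
  obtain x b where c: "c = (x, b)" by (cases c)
  let ?f = "word_act w (\<lambda>_. 1)"
  let ?g = "\<lambda>B. ?f (reversal x ` B)"
  have act: "word_act (c # w) (\<lambda>_. 1) B = set_reflection (span x) ?g B" for B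
    by (simp add: c gen_act_def)
  have gx: "?g (span x) = ?f (span x)" by (simp add: image_reversal_superset)
  {
    \<comment> \<open>The three conclusions have separate minimality premises. Their common facts
      are proved once and quoted by position: \<open>facts(5)\<close> is \<open>pos\<close>,
      \<open>facts(7)\<close> is \<open>sum\<close>.\<close>
    assume min: "minimal_word (c # w)"
    note minw = minimal_word_Cons[OF min]
    have x: "x \<in> S" and w: "w \<in> words S" using min by (auto simp: minimal_word_def c)
    have cw: "c # w \<approx> (x, True) # w"
      using sub_cactus_cong_append_right[OF sub_cactus_cong_letter[OF x] w] by (simp add: c)
    have cong: "c # w \<approx> (x, True) # v" if "w \<approx> v" for v
      using cw sub_cactus_cong_append_left[OF that, of "[(x, True)]"] x
      by (auto intro: pres_cong.trans)
    \<comment> \<open>Otherwise the induction hypothesis lets \<open>w\<close> begin with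
      \<open>x\<close> as well; the two copies of \<open>x\<close> cancel and leave a word shorter
      by two letters.\<close>
    have pos: "?f (span x) > 0"
    proof (rule ccontr)
      assume "\<not> ?f (span x) > 0"
      then obtain y v where y: "y \<in> S" "span y = span x" "w \<approx> (y, True) # v"
          "length w = Suc (length v)"
        using Cons.IH(1)[OF minw] by blast
      have "y = x" using y(1,2) x
        by (cases x; cases y) (auto simp: span_def sub_cactus_gens_def cactus_gens_def)
      have "v \<in> words S" using pres_cong_words[OF sub_cactus_rels_words y(3)] by simp
      then have "(x, True) # (x, True) # v \<approx> v"
        using sub_cactus_cong_append_right[OF sub_cactus_cong_square[OF x]] by fastforce
      with cong[OF y(3)] have "c # w \<approx> v" unfolding \<open>y = x\<close> by (rule pres_cong.trans)
      then show False using min y(4) by (auto simp: minimal_word_def)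
    qed
    have sum: "?g B + ?g C > 0" if "\<not> disjoint_or_nested B C" for B C
      using Cons.IH(2)[OF _ minw] that by (simp add: disjoint_or_nested_image inj_reversal)
    note x w cw cong pos minw sum
  }
  note * = this
  {
    case 1
    note facts = *[OF 1]
    consider "A = span x" | "\<not> disjoint_or_nested (span x) A"
      | "A \<noteq> span x" "disjoint_or_nested (span x) A" by blast
    then show ?case
    proof cases
      case 1
      then have "word_act (c # w) (\<lambda>_. 1) A < 0"
        using facts(5) gx unfolding act by (simp add: set_reflection_def)
      moreover have "\<exists>x v. x \<in> S \<and> span x = A \<and> c # w \<approx> (x, True) # v \<and>
          length (c # w) = Suc (length v)"
        using facts(1,3) 1 by (intro exI[of _ x] exI[of _ w]) simp
      ultimately show ?thesis by blast
    next
      case 2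
      then have "word_act (c # w) (\<lambda>_. 1) A = ?g A + 2 * ?g (span x)"
        unfolding act by (auto simp: set_reflection_def)
      \<comment> \<open>The value is \<open>?g A + ?g (span x)\<close>, positive by
        \<open>facts(7)\<close>, plus another positive \<open>?g (span x)\<close>.\<close>
      then show ?thesis using facts(5) facts(7)[OF 2] gx by linarith
    next
      case 3
      then have eq: "word_act (c # w) (\<lambda>_. 1) A = ?g A"
        unfolding act by (simp add: set_reflection_def)
      show ?thesis
      proof (cases "?g A > 0")
        case False
        \<comment> \<open>Only the reversal matters at \<open>A\<close> here, so negativity is
          inherited from \<open>w\<close>, which can be made to begin with \<open>y\<close>.
          Exchanging \<open>y\<close> with \<open>x\<close> brings a generator with span
          \<open>A\<close> to the front.\<close>
        then obtain y v where y: "y \<in> S" "span y = reversal x ` A" "w \<approx> (y, True) # v"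
            "length w = Suc (length v)" and neg: "?g A < 0"
          using Cons.IH(1)[OF facts(6), of "reversal x ` A"] by blast
        have A: "A = reversal x ` span y" using y(2) by simp
        obtain z x' where z: "z \<in> S" "x' \<in> S" "span z = A"
            "[(x, True), (y, True)] \<approx> [(z, True), (x', True)]"
          using sub_cactus_cong_swap[OF facts(1) y(1)] 3(2) unfolding A by blast
        have "v \<in> words S" using pres_cong_words[OF sub_cactus_rels_words y(3)] by simp
        then have "(x, True) # (y, True) # v \<approx> (z, True) # (x', True) # v"
          using sub_cactus_cong_append_right[OF z(4)] by fastforce
        with facts(4)[OF y(3)] have "c # w \<approx> (z, True) # (x', True) # v"
          by (rule pres_cong.trans)
        then have "\<exists>x v. x \<in> S \<and> span x = A \<and> c # w \<approx> (x, True) # v \<and>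
            length (c # w) = Suc (length v)"
          using z(1,3) y(4) by (intro exI[of _ z] exI[of _ "(x', True) # v"]) simp
        then show ?thesis using neg unfolding eq by blast
      qed (simp only: eq, blast)
    qed
  next
    case 2
    \<comment> \<open>If \<open>A\<close> or \<open>B\<close> is \<open>span x\<close>, the new sum
      equals \<open>?g A + ?g B\<close>; otherwise it is this plus 0, 2 or 4 times
      \<open>?f (span x)\<close>.\<close>
    note facts = *[OF 2(2)]
    have "?g A + ?g B > 0" "disjoint_or_nested A B = disjoint_or_nested B A"
      using facts(7)[OF 2(1)] disjoint_or_nested_sym by auto
    with 2(1) facts(5) gx show ?case
      unfolding act by (auto simp: set_reflection_def)
  next
    case 3
    then show ?case using 3(1) *(5)[OF 3(2)] gx
      unfolding act by (auto simp: set_reflection_def c)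
  }
qed

lemma sub_cactus_cong_Nil:
  assumes "w \<in> words S" "(w, []) \<in> pres_cong (cactus_gens n) (cactus_rels n)"
  shows "w \<approx> []"
proof -
  obtain v where v: "w \<approx> v" "minimal_word v" using minimal_word_exists[OF assms(1)] .
  have "(v, w) \<in> pres_cong (cactus_gens n) (cactus_rels n)"
    using v(1) sub_cactus_cong_subset by (blast intro: pres_cong.sym)
  then have "word_act v (\<lambda>_. 1) = word_act [] (\<lambda>_. 1)"
    using assms(2) by (metis word_act_cong)
  \<comment> \<open>A first letter would make the value at its span negative, but all values are
    1.\<close>
  then have "v = []" using word_act_minimal_word(3)[OF v(2)] by (cases v) auto
  with v(1) show ?thesis by simp
qed

end

section \<open>The homomorphism\<close>

lemma carrier_sub_cactus_group:
  "carrier (sub_cactus_group n i j) = words (sub_cactus_gens n i j) // sub_cactus_cong n i j"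
  by (simp add: sub_cactus_group_def presented_group_def)

lemma sub_cactus_words_subset: "words (sub_cactus_gens n i j) \<subseteq> words (cactus_gens n)"
  by (rule words_mono) (auto simp: sub_cactus_gens_def)

text \<open>The congruence of J_n is coarser, so the image of a class of J_n^{i,j} is the full class
  in J_n of any of its words; no representative has to be chosen.\<close>

definition sub_cactus_hom :: "nat \<Rightarrow> (nat \<times> nat) word set \<Rightarrow> (nat \<times> nat) word set" where
  "sub_cactus_hom n X = pres_cong (cactus_gens n) (cactus_rels n) `` X"

lemma sub_cactus_hom_class:
  assumes "w \<in> words (sub_cactus_gens n i j)"
  shows "sub_cactus_hom n (sub_cactus_cong n i j `` {w}) =
    pres_cong (cactus_gens n) (cactus_rels n) `` {w}"
  using assms sub_cactus_cong_subset[of n i j]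
  by (auto simp: sub_cactus_hom_def intro: pres_cong.trans pres_cong.refl)

lemma sub_cactus_hom_in_hom:
  "sub_cactus_hom n \<in> hom (sub_cactus_group n i j) (cactus_group n)"
proof (rule homI)
  fix A assume "A \<in> carrier (sub_cactus_group n i j)"
  then obtain a where a: "a \<in> words (sub_cactus_gens n i j)" "A = sub_cactus_cong n i j `` {a}"
    by (auto simp: carrier_sub_cactus_group elim: quotientE)
  have a': "a \<in> words (cactus_gens n)" using a(1) sub_cactus_words_subset by blast
  then show "sub_cactus_hom n A \<in> carrier (cactus_group n)"
    using a by (simp add: sub_cactus_hom_class cactus_group_def presented_group_def quotientI)
  fix B assume "B \<in> carrier (sub_cactus_group n i j)"
  then obtain b where b: "b \<in> words (sub_cactus_gens n i j)" "B = sub_cactus_cong n i j `` {b}"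
    by (auto simp: carrier_sub_cactus_group elim: quotientE)
  have b': "b \<in> words (cactus_gens n)" using b(1) sub_cactus_words_subset by blast
  show "sub_cactus_hom n (A \<otimes>\<^bsub>sub_cactus_group n i j\<^esub> B) =
      sub_cactus_hom n A \<otimes>\<^bsub>cactus_group n\<^esub> sub_cactus_hom n B"
    using a b a' b'
    by (simp add: sub_cactus_group_def cactus_group_def sub_cactus_hom_class
        presented_group_mult[OF sub_cactus_rels_words] presented_group_mult[OF cactus_rels_words])
qed

text \<open>The values on generators determine those on all words because a formal inverse is
  congruent to its generator.\<close>

lemma hom_sub_cactus_group_class:
  assumes hom: "\<phi> \<in> hom (sub_cactus_group n i j) (cactus_group n)"
    and gens: "\<forall>g \<in> sub_cactus_gens n i j. \<phi> (sub_cactus_s n i j g) = cactus_s n g"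
    and "w \<in> words (sub_cactus_gens n i j)"
  shows "\<phi> (sub_cactus_cong n i j `` {w}) = pres_cong (cactus_gens n) (cactus_rels n) `` {w}"
  using assms(3)
proof (induction w)
  case Nil
  show ?case using hom_one[OF hom group_sub_cactus_group group_cactus_group]
    by (simp add: sub_cactus_group_def cactus_group_def presented_group_def)
next
  case (Cons a w)
  let ?J = "pres_cong (cactus_gens n) (cactus_rels n)"
  obtain x b where a: "a = (x, b)" by (cases a)
  have x: "x \<in> sub_cactus_gens n i j" and w: "w \<in> words (sub_cactus_gens n i j)"
    using Cons.prems a by auto
  have x': "x \<in> cactus_gens n" and w': "w \<in> words (cactus_gens n)"
    using x w sub_cactus_words_subset by (auto simp: sub_cactus_gens_def)
  note letter = sub_cactus_cong_letter[OF x, of b]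
  have eq: "sub_cactus_cong n i j `` {[a]} = sub_cactus_s n i j x"
    using equiv_class_eq[OF equiv_pres_cong[OF sub_cactus_rels_words] letter]
    by (simp add: a sub_cactus_s_def pres_gen_def)
  have eq': "?J `` {[a]} = cactus_s n x"
    using equiv_class_eq[OF equiv_pres_cong[OF cactus_rels_words]] letter
      sub_cactus_cong_subset[of n i j]
    by (auto simp: a cactus_s_def pres_gen_def)
  have "\<phi> (sub_cactus_cong n i j `` {a # w}) =
      \<phi> (sub_cactus_cong n i j `` {[a]} \<otimes>\<^bsub>sub_cactus_group n i j\<^esub> sub_cactus_cong n i j `` {w})"
    using presented_group_mult[OF sub_cactus_rels_words, of "[a]" n i j w] x w
    by (simp add: a sub_cactus_group_def)
  also have "\<dots> = \<phi> (sub_cactus_cong n i j `` {[a]}) \<otimes>\<^bsub>cactus_group n\<^esub>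
      \<phi> (sub_cactus_cong n i j `` {w})"
    using x w by (intro hom_mult[OF hom]) (auto simp: a carrier_sub_cactus_group quotientI)
  also have "\<dots> = ?J `` {[a]} \<otimes>\<^bsub>cactus_group n\<^esub> ?J `` {w}"
    using Cons.IH[OF w] gens x eq eq' by simp
  also have "\<dots> = ?J `` {a # w}"
    using presented_group_mult[OF cactus_rels_words, of "[a]" n w] x' w'
    by (simp add: a cactus_group_def)
  finally show ?case .
qed

text \<open>The existence part ensures that the injectivity part, stated for every such
  homomorphism, is not vacuous.\<close>

theorem theoremA:
  fixes n i j :: nat
  assumes "2 \<le> i" and "i \<le> j" and "j \<le> n"
  shows "(\<exists>\<phi> \<in> hom (sub_cactus_group n i j) (cactus_group n).
            \<forall>g \<in> sub_cactus_gens n i j. \<phi> (sub_cactus_s n i j g) = cactus_s n g) \<and>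
         (\<forall>\<phi> \<in> hom (sub_cactus_group n i j) (cactus_group n).
            (\<forall>g \<in> sub_cactus_gens n i j. \<phi> (sub_cactus_s n i j g) = cactus_s n g) \<longrightarrow>
            inj_on \<phi> (carrier (sub_cactus_group n i j)))"
proof (intro conjI ballI impI)
  have "\<forall>g \<in> sub_cactus_gens n i j. sub_cactus_hom n (sub_cactus_s n i j g) = cactus_s n g"
    by (simp add: sub_cactus_s_def cactus_s_def pres_gen_def sub_cactus_hom_class)
  then show "\<exists>\<phi> \<in> hom (sub_cactus_group n i j) (cactus_group n).
      \<forall>g \<in> sub_cactus_gens n i j. \<phi> (sub_cactus_s n i j g) = cactus_s n g"
    using sub_cactus_hom_in_hom by blast
next
  fix \<phi> assume hom: "\<phi> \<in> hom (sub_cactus_group n i j) (cactus_group n)"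
    and gens: "\<forall>g \<in> sub_cactus_gens n i j. \<phi> (sub_cactus_s n i j g) = cactus_s n g"
  interpret group_hom "sub_cactus_group n i j" "cactus_group n" \<phi>
    using hom group_sub_cactus_group group_cactus_group
    by (simp add: group_hom_def group_hom_axioms_def)
  show "inj_on \<phi> (carrier (sub_cactus_group n i j))"
    unfolding inj_on_one_iff
  proof (intro allI impI)
    fix A assume "A \<in> carrier (sub_cactus_group n i j)" and one: "\<phi> A = \<one>\<^bsub>cactus_group n\<^esub>"
    then obtain w where w: "w \<in> words (sub_cactus_gens n i j)" "A = sub_cactus_cong n i j `` {w}"
      by (auto simp: carrier_sub_cactus_group elim: quotientE)
    have "pres_cong (cactus_gens n) (cactus_rels n) `` {w} =
        pres_cong (cactus_gens n) (cactus_rels n) `` {[]}"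
      using one hom_sub_cactus_group_class[OF hom gens w(1)] w(2)
      by (simp add: cactus_group_def presented_group_def)
    then have "(w, []) \<in> pres_cong (cactus_gens n) (cactus_rels n)"
      using eq_equiv_class[OF _ equiv_pres_cong[OF cactus_rels_words]] by simp
    then have "(w, []) \<in> sub_cactus_cong n i j" by (rule sub_cactus_cong_Nil[OF w(1)])
    then show "A = \<one>\<^bsub>sub_cactus_group n i j\<^esub>"
      using equiv_class_eq[OF equiv_pres_cong[OF sub_cactus_rels_words]] w(2)
      by (simp add: sub_cactus_group_def presented_group_def)
  qed
qed

end
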